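(* (Cauchy's integral theorem for the complex Riccati equation.) Let $\Omega\subset\mathbb{C}$ be a domain, let $\nu:\Omega\to\mathbb{R}$ be a real-valued function, and let $Q_0$ and $Q_1$ be bounded solutions in $\Omega$ of the complex differential Riccati equation $$\partial_{\overline z}Q+|Q|^2=\frac{\nu}{4}.$$ Then for every closed curve $\Gamma$ lying in a simply connected subdomain of $\Omega$, $$\operatorname{Re}\int_{\Gamma}(Q_1-Q_0)\,e^{A[Q_1-Q_0]}\,dz+i\operatorname{Im}\int_{\Gamma}(Q_1-Q_0)\,e^{A[Q_1+Q_0]}\,dz=0.$$
   Context: Here $z=x+iy$, $\partial_{\overline z}=\frac12(\partial_x+i\partial_y)$, $\partial_z=\frac12(\partial_x-i\partial_y)$. Functions $Q$ are complex-valued, not assumed analytic; solutions are understood in the classical sense (continuously differentiable), and closed curves are rectifiable. For a complex-valued function $\Phi=\Phi_1+i\Phi_2$ (with $\Phi_1,\Phi_2$ real) on a simply connected domain satisfying $\partial_y\Phi_1+\partial_x\Phi_2=0$, one defines the real-valued function $$A[\Phi](x,y)=2\int_{\gamma}(\Phi_1\,dx-\Phi_2\,dy)+c,$$ where $\gamma$ is an arbitrary rectifiable curve in the domain from a fixed point $(x_0,y_0)$ to $(x,y)$ and $c$ is an arbitrary real constant; it satisfies $\partial_zA[\Phi]=\Phi$. Every solution of the Riccati equation satisfies this compatibility condition (the imaginary part of the equation), hence so do $Q_1\pm Q_0$. In the theorem $A$ is taken on the simply connected subdomain containing $\Gamma$. *)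

theory Defs
  imports "HOL-Analysis.Analysis"
begin

section \<open>Integrals along rectifiable curves\<close>

text \<open>
  The library's \<open>contour_integral\<close> is restricted to piecewise continuously differentiable
  paths. Curves here are merely rectifiable, so integrals along them are Riemann--Stieltjes
  integrals over the parameter interval. The limit is the one over the mesh (a constant radius
  in place of a general gauge).
\<close>

definition has_rs_integral ::
  "(real \<Rightarrow> 'a::real_normed_algebra) \<Rightarrow> (real \<Rightarrow> 'a) \<Rightarrow> 'a \<Rightarrow> bool" where
  "has_rs_integral f g I \<longleftrightarrow>
     (\<forall>e>0. \<exists>d>0. \<forall>p. p tagged_division_of {0..1} \<and> (\<lambda>t. ball t d) fine p \<longrightarrow>
        norm ((\<Sum>(t,k)\<in>p. f t * (g (Sup k) - g (Inf k))) - I) < e)"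

definition rs_integral ::
  "(real \<Rightarrow> 'a::real_normed_algebra) \<Rightarrow> (real \<Rightarrow> 'a) \<Rightarrow> 'a" where
  "rs_integral f g = (THE I. has_rs_integral f g I)"

lemma has_rs_integral_unique:
  assumes "has_rs_integral f g I" "has_rs_integral f g J"
  shows "I = J"
proof (rule ccontr)
  assume "I \<noteq> J"
  define e where "e = norm (I - J) / 2"
  have "e > 0"
    using \<open>I \<noteq> J\<close> by (simp add: e_def)
  define S where "S p = (\<Sum>(t,k)\<in>p. f t * (g (Sup k) - g (Inf k)))" for p
  obtain d1 where d1: "d1 > 0"
    "\<And>p. p tagged_division_of {0..1} \<Longrightarrow> (\<lambda>t. ball t d1) fine p \<Longrightarrow> norm (S p - I) < e"
    using assms(1) \<open>e > 0\<close> unfolding has_rs_integral_def S_def by meson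
  obtain d2 where d2: "d2 > 0"
    "\<And>p. p tagged_division_of {0..1} \<Longrightarrow> (\<lambda>t. ball t d2) fine p \<Longrightarrow> norm (S p - J) < e"
    using assms(2) \<open>e > 0\<close> unfolding has_rs_integral_def S_def by meson
  have "gauge (\<lambda>t::real. ball t (min d1 d2))"
    using d1(1) d2(1) by (simp add: gauge_ball)
  then obtain p where p: "p tagged_division_of {0..1::real}" "(\<lambda>t. ball t (min d1 d2)) fine p"
    using fine_division_exists_real by blast
  have "(\<lambda>t. ball t d1) fine p" "(\<lambda>t. ball t d2) fine p"
    using p(2) by (force simp: fine_def)+
  then have "norm (S p - I) < e" "norm (S p - J) < e"
    using d1(2) d2(2) p(1) by blast+
  then have "norm (I - J) < 2 * e"
    using norm_triangle_ineq4[of "S p - J" "S p - I"] by simp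
  then show False
    by (simp add: e_def)
qed

lemma rs_integral_eq: "has_rs_integral f g I \<Longrightarrow> rs_integral f g = I"
  unfolding rs_integral_def by (blast intro: the_equality has_rs_integral_unique)

definition rectifiable_path :: "(real \<Rightarrow> complex) \<Rightarrow> bool" where
  "rectifiable_path \<gamma> \<longleftrightarrow> path \<gamma> \<and>
     (\<exists>L. \<forall>d. d division_of {0..1} \<longrightarrow> (\<Sum>k\<in>d. norm (\<gamma> (Sup k) - \<gamma> (Inf k))) \<le> L)"

definition curve_integral :: "(real \<Rightarrow> complex) \<Rightarrow> (complex \<Rightarrow> complex) \<Rightarrow> complex" where
  "curve_integral \<gamma> f = rs_integral (\<lambda>t. f (\<gamma> t)) \<gamma>"

text \<open>The real line integral of \<open>P dx + R dy\<close> along \<open>\<gamma>\<close>.\<close>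

definition line_integral ::
  "(real \<Rightarrow> complex) \<Rightarrow> (complex \<Rightarrow> real) \<Rightarrow> (complex \<Rightarrow> real) \<Rightarrow> real" where
  "line_integral \<gamma> P R =
     rs_integral (\<lambda>t. P (\<gamma> t)) (\<lambda>t. Re (\<gamma> t)) + rs_integral (\<lambda>t. R (\<gamma> t)) (\<lambda>t. Im (\<gamma> t))"


section \<open>The complex Riccati equation\<close>

text \<open>
  Derivatives are real (Frechet) derivatives; \<open>f\<close> need not be holomorphic.
\<close>

definition partial_x :: "(complex \<Rightarrow> complex) \<Rightarrow> complex \<Rightarrow> complex" where
  "partial_x f z = frechet_derivative f (at z) 1"

definition partial_y :: "(complex \<Rightarrow> complex) \<Rightarrow> complex \<Rightarrow> complex" where
  "partial_y f z = frechet_derivative f (at z) \<i>"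

definition partial_zbar :: "(complex \<Rightarrow> complex) \<Rightarrow> complex \<Rightarrow> complex" where
  "partial_zbar f z = (partial_x f z + \<i> * partial_y f z) / 2"

definition continuously_differentiable :: "complex set \<Rightarrow> (complex \<Rightarrow> complex) \<Rightarrow> bool" where
  "continuously_differentiable S f \<longleftrightarrow>
     (\<forall>z\<in>S. f differentiable (at z)) \<and>
     continuous_on S (partial_x f) \<and> continuous_on S (partial_y f)"

definition riccati_solution ::
  "complex set \<Rightarrow> (complex \<Rightarrow> real) \<Rightarrow> (complex \<Rightarrow> complex) \<Rightarrow> bool" where
  "riccati_solution \<Omega> \<nu> Q \<longleftrightarrow> continuously_differentiable \<Omega> Q \<and>
     (\<forall>z\<in>\<Omega>. partial_zbar Q z + complex_of_real ((cmod (Q z))\<^sup>2) = complex_of_real (\<nu> z / 4))"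


section \<open>The operator A\<close>

text \<open>
  \<open>A_op D z0 c \<Phi>\<close> is the function \<open>A[\<Phi>]\<close> on \<open>D\<close> with base point \<open>z0\<close> and additive constant
  \<open>c\<close>. The curve joining \<open>z0\<close> to \<open>z\<close> in \<open>D\<close> is left unspecified: the value does not depend on it
  when \<open>D\<close> is a simply connected domain and \<open>\<Phi>\<close> satisfies the compatibility condition
  \<open>\<partial>\<^sub>y Re \<Phi> + \<partial>\<^sub>x Im \<Phi> = 0\<close>.
\<close>

definition joining_curve :: "complex set \<Rightarrow> complex \<Rightarrow> complex \<Rightarrow> (real \<Rightarrow> complex) \<Rightarrow> bool" where
  "joining_curve D z0 z \<gamma> \<longleftrightarrow>
     rectifiable_path \<gamma> \<and> path_image \<gamma> \<subseteq> D \<and> pathstart \<gamma> = z0 \<and> pathfinish \<gamma> = z"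

definition A_op ::
  "complex set \<Rightarrow> complex \<Rightarrow> real \<Rightarrow> (complex \<Rightarrow> complex) \<Rightarrow> complex \<Rightarrow> real" where
  "A_op D z0 c \<Phi> z =
     2 * line_integral (SOME \<gamma>. joining_curve D z0 z \<gamma>) (\<lambda>w. Re (\<Phi> w)) (\<lambda>w. - Im (\<Phi> w)) + c"

end

(* Put W = Q1 - Q0 and S = Q1 + Q0. Since the z-derivative of A[W] is W, the form
   Re (W e^(A[W]) dz) is the differential of e^(A[W]) / 2. The form Im (W e^(A[S]) dz) is closed:
   subtracting the two Riccati equations gives dW/dzbar = -Re (W conj S), which is exactly the
   closedness condition. On a simply connected domain it has a primitive, by the Poincare
   lemma on the disc transported through the Riemann mapping. Finally, an exact form integrates
   to zero along a closed rectifiable curve. *)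
theory Submission
  imports Defs "HOL-Complex_Analysis.Riemann_Mapping"
begin

section \<open>Riemann--Stieltjes integrals\<close>

text \<open>A merely rectifiable curve offers no derivative to integrate against, and its integrals
  are definite descriptions that say nothing until convergence is proved. Continuity of the
  integrand and bounded variation of the curve supply convergence; the value for an exact form then
  comes from telescoping increments. Both halves of the theorem are reduced to one shape, the real
  form \<open>Re (f dz)\<close>, because \<open>Im (g dz)\<close> is
  \<open>Re (- \<i> g dz)\<close>. A primitive of such a form also settles the arbitrary choice of
  curve in \<open>A_op\<close>: every joining curve gives the same difference of end values. The
  primitive is built by integrating along rays from 0, which needs the rays to stay in the domain;
  hence the detour through the disc.\<close>

definition mesh_filter :: "(real \<times> real set) set filter" where
  "mesh_filter = (INF d\<in>{0<..}. principal {p. p tagged_division_of {0..1} \<and> (\<lambda>t. ball t d) fine p})"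

definition rs_sum :: "(real \<Rightarrow> 'a::real_normed_algebra) \<Rightarrow> (real \<Rightarrow> 'a) \<Rightarrow> (real \<times> real set) set \<Rightarrow> 'a" where
  "rs_sum f g p = (\<Sum>(t,k)\<in>p. f t * (g (Sup k) - g (Inf k)))"

text \<open>\<open>Sup {}\<close> and \<open>Inf {}\<close> are unspecified reals, while cells of
  two divisions often have empty intersection. The value 0 there keeps the increment additive when
  an interval is cut.\<close>

definition increment :: "(real \<Rightarrow> 'a::real_normed_vector) \<Rightarrow> real set \<Rightarrow> 'a" where
  "increment g k = (if k = {} then 0 else g (Sup k) - g (Inf k))"

text \<open>The family of principal filters is directed, since the smaller of two radii serves both;
  so a single radius witnesses an eventual property.\<close>

lemma eventually_mesh_filter:
  "eventually P mesh_filter \<longleftrightarrow>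
    (\<exists>d>0. \<forall>p. p tagged_division_of {0..1} \<and> (\<lambda>t. ball t d) fine p \<longrightarrow> P p)"
proof -
  have *: "(\<lambda>t::real. ball t a) fine p \<and> (\<lambda>t. ball t b) fine p" if "(\<lambda>t. ball t (min a b)) fine p"
    for p :: "(real \<times> real set) set" and a b
    using that by (force simp: fine_def)
  have le: "{p. p tagged_division_of {0..1} \<and> (\<lambda>t::real. ball t (min a b)) fine p} \<subseteq>
      {p. p tagged_division_of {0..1} \<and> (\<lambda>t. ball t a) fine p} \<inter>
      {p. p tagged_division_of {0..1} \<and> (\<lambda>t. ball t b) fine p}" for a b
    using * by blast
  show ?thesis
    unfolding mesh_filter_def
  proof (subst eventually_INF_base)
    show "\<exists>x\<in>{0<..}. principal {p. p tagged_division_of {0..1} \<and> (\<lambda>t::real. ball t x) fine p}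
        \<le> inf (principal {p. p tagged_division_of {0..1} \<and> (\<lambda>t. ball t a) fine p})
              (principal {p. p tagged_division_of {0..1} \<and> (\<lambda>t. ball t b) fine p})"
      if "a \<in> {0<..}" "b \<in> {0<..}" for a b :: real
      using that le[of a b] by (intro bexI[of _ "min a b"]) simp_all
  qed (auto simp: eventually_principal)
qed

lemma has_rs_integral_iff: "has_rs_integral f g I \<longleftrightarrow> (rs_sum f g \<longlongrightarrow> I) mesh_filter"
  by (simp add: has_rs_integral_def tendsto_iff eventually_mesh_filter rs_sum_def dist_norm)

text \<open>Although the mesh is uniform, every gauge is met by arbitrarily fine divisions, so a limit
  along the mesh may be computed with a gauge chosen pointwise.\<close>

lemma frequently_mesh_filter_fine:
  assumes "gauge \<eta>"
  shows "\<exists>\<^sub>F p in mesh_filter. p tagged_division_of {0..1} \<and> \<eta> fine p"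
  unfolding frequently_def eventually_mesh_filter
proof safe
  fix d :: real
  assume d: "d > 0" "\<forall>p. p tagged_division_of {0..1} \<and> (\<lambda>t. ball t d) fine p \<longrightarrow>
    \<not> (p tagged_division_of {0..1} \<and> \<eta> fine p)"
  have "gauge (\<lambda>t. ball t d \<inter> \<eta> t)"
    using assms d(1) by (intro gauge_Int) (auto simp: gauge_ball)
  then obtain p where "p tagged_division_of {0..1}" "(\<lambda>t. ball t d \<inter> \<eta> t) fine p"
    using fine_division_exists_real by blast
  then show False
    using d(2) by (auto simp: fine_Int)
qed

lemma mesh_filter_neq_bot: "mesh_filter \<noteq> bot"
proof
  have "gauge (\<lambda>t::real. ball t 1)"
    by (simp add: gauge_ball)
  moreover assume "mesh_filter = bot"
  ultimately show False
    using frequently_mesh_filter_fine by (simp add: frequently_def)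
qed

section \<open>Increments over divisions and common refinements\<close>

lemma increment_degenerate: "box a b = {} \<Longrightarrow> increment g (cbox a b) = 0"
  by (auto simp: increment_def)

lemma tagged_division_01_cases:
  assumes "p tagged_division_of {0..1::real}" "(t, k) \<in> p"
  obtains a b where "k = {a..b}" "a \<le> t" "t \<le> b" "0 \<le> a" "b \<le> 1"
proof -
  obtain a b where "k = {a..b}" using tagged_division_ofD(4)[OF assms] by auto
  moreover have "t \<in> k" "k \<subseteq> {0..1}" using tagged_division_ofD(2,3)[OF assms] by auto
  ultimately show ?thesis by (intro that) auto
qed

text \<open>For fixed \<open>k\<close> the map \<open>l \<mapsto> increment g (k \<inter> l)\<close>
  is additive when \<open>l\<close> is cut at a point, so its sum over a division depends only on
  the interval divided.\<close>

lemma sum_increment_restrict: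
  assumes "q tagged_division_of {0..1}" "k = {a..b}" "k \<subseteq> {0..1}"
  shows "(\<Sum>(s,l)\<in>q. increment g (k \<inter> l)) = increment g k"
proof -
  interpret operative_real plus 0 "\<lambda>l. increment g (k \<inter> l)"
    rewrites "comm_monoid_set.F (+) 0 = sum"
  proof -
    show "operative_real plus 0 (\<lambda>l. increment g (k \<inter> l))"
    proof
      fix u v w :: real
      show "increment g (k \<inter> {u..v}) = 0" if "v \<le> u"
        using that assms(2) by (auto simp: increment_def)
      show "increment g (k \<inter> {u..w}) + increment g (k \<inter> {w..v}) = increment g (k \<inter> {u..v})"
        if "u < w" "w < v"
        using that assms(2) by (auto simp: increment_def max_def min_def)
    qed
  qed (simp add: sum_def)
  have "(\<Sum>(s,l)\<in>q. increment g (k \<inter> l)) = increment g (k \<inter> {0..1})"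
    using tagged_division[of q 0 1] assms(1) by simp
  then show ?thesis
    using assms(3) by (simp add: Int_absorb2)
qed

text \<open>The variation bound speaks of sets of cells, the sum of tagged cells. Two tags can share
  a cell only if it is degenerate, and its increment is then 0.\<close>

lemma sum_norm_tagged_le:
  fixes g :: "real \<Rightarrow> 'a::real_normed_vector"
  assumes "\<And>d. d division_of {0..1} \<Longrightarrow> (\<Sum>k\<in>d. norm (g (Sup k) - g (Inf k))) \<le> L"
    and "p tagged_division_of {0..1}"
  shows "(\<Sum>(t,k)\<in>p. norm (g (Sup k) - g (Inf k))) \<le> L"
proof -
  have ne: "k \<noteq> {}" if "k \<in> snd ` p" for k
    using that tagged_division_ofD(2)[OF assms(2)] by (metis empty_iff imageE prod.collapse)
  have "(\<Sum>(t,k)\<in>p. norm (g (Sup k) - g (Inf k))) = (\<Sum>(t,k)\<in>p. norm (increment g k))"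
    using ne by (intro sum.cong refl) (force simp: increment_def split: prod.splits)
  also have "\<dots> = (\<Sum>k\<in>snd ` p. norm (increment g k))"
    using assms(2) by (intro sum.over_tagged_division_lemma) (auto simp: increment_def)
  also have "\<dots> = (\<Sum>k\<in>snd ` p. norm (g (Sup k) - g (Inf k)))"
    using ne by (intro sum.cong) (auto simp: increment_def)
  also have "\<dots> \<le> L"
    using assms division_of_tagged_division by blast
  finally show ?thesis .
qed

text \<open>The nonempty intersections of cells form a division of the unit interval, to which the
  variation bound applies.\<close>

lemma sum_norm_common_refinement_le:
  fixes g :: "real \<Rightarrow> 'a::real_normed_vector"
  assumes bv: "\<And>d. d division_of {0..1} \<Longrightarrow> (\<Sum>k\<in>d. norm (g (Sup k) - g (Inf k))) \<le> L"
    and p: "p tagged_division_of {0..1}" and q: "q tagged_division_of {0..1}"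
  shows "(\<Sum>(t,k)\<in>p. \<Sum>(s,l)\<in>q. norm (increment g (k \<inter> l))) \<le> L"
proof -
  let ?h = "\<lambda>x. (case x of ((t, k), (s, l)) \<Rightarrow> k \<inter> l) :: real set"
  let ?n = "\<lambda>k. norm (increment g k)"
  note pD = tagged_division_ofD[OF p] and qD = tagged_division_ofD[OF q]
  have fin: "finite (p \<times> q)"
    using pD(1) qD(1) by simp
  have int0: "increment g (k \<inter> l) = 0"
    if int: "interior (k \<inter> l) = {}" and tk: "(t, k) \<in> p" and sl: "(s, l) \<in> q" for t s k l
  proof -
    obtain a b c d where "k = {a..b}" "l = {c..d}"
      using pD(4)[OF tk] qD(4)[OF sl] by auto
    then have "k \<inter> l = cbox (max a c) (min b d)"
      by auto
    then show ?thesis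
      using int by (simp only: interior_cbox increment_degenerate)
  qed
  have "(\<Sum>(t,k)\<in>p. \<Sum>(s,l)\<in>q. ?n (k \<inter> l)) = sum (?n \<circ> ?h) (p \<times> q)"
    by (simp add: sum.cartesian_product split_def comp_def)
  also have "\<dots> = sum ?n (?h ` (p \<times> q))"
  \<comment> \<open>Distinct pairs may have the same intersection, such as a shared endpoint. Its
    interior lies in two disjoint interiors, so it is degenerate and counting it once or twice is
    the same.\<close>
  proof (rule sum.reindex_nontrivial[symmetric, OF fin])
    fix x y assume xy: "x \<in> p \<times> q" "y \<in> p \<times> q" "x \<noteq> y" "?h x = ?h y"
    obtain t k s l t' k' s' l' where x: "x = ((t, k), (s, l))" and y: "y = ((t', k'), (s', l'))"
      by (metis surj_pair)
    have mem: "(t, k) \<in> p" "(s, l) \<in> q" "(t', k') \<in> p" "(s', l') \<in> q"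
      and ne: "(t, k) \<noteq> (t', k') \<or> (s, l) \<noteq> (s', l')" and eq: "k \<inter> l = k' \<inter> l'"
      using xy unfolding x y by auto
    have "interior (k \<inter> l) \<subseteq> interior k \<inter> interior k' \<inter> interior l \<inter> interior l'"
      using interior_Int[of k l] interior_Int[of k' l'] eq by auto
    moreover have "interior k \<inter> interior k' = {} \<or> interior l \<inter> interior l' = {}"
      using ne pD(5)[OF mem(1,3)] qD(5)[OF mem(2,4)] by auto
    ultimately have "interior (k \<inter> l) = {}"
      by blast
    then show "?n (?h x) = 0"
      using int0 mem(1,2) by (simp add: x)
  qed
  also have "\<dots> = sum ?n (?h ` (p \<times> q) - {{}})"
    using fin by (intro sum.mono_neutral_right) (auto simp: increment_def)
  also have "?h ` (p \<times> q) - {{}} =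
      {k \<inter> l | k l. k \<in> snd ` p \<and> l \<in> snd ` q \<and> k \<inter> l \<noteq> {}}" (is "_ = ?D")
    by (fastforce simp: image_iff)
  also have "sum ?n ?D = (\<Sum>k\<in>?D. norm (g (Sup k) - g (Inf k)))"
    by (intro sum.cong) (auto simp: increment_def)
  also have "\<dots> \<le> L"
    using division_inter[OF division_of_tagged_division[OF p] division_of_tagged_division[OF q]]
    by (intro bv) simp
  finally show ?thesis .
qed

text \<open>Cauchy criterion: on the common refinement two fine sums differ only through the tags,
  hence by at most the oscillation of \<open>f\<close> times the variation of
  \<open>g\<close>.\<close>

lemma has_rs_integral_exists:
  fixes f g :: "real \<Rightarrow> real"
  assumes f: "continuous_on {0..1} f"
    and bv: "\<And>d. d division_of {0..1} \<Longrightarrow> (\<Sum>k\<in>d. norm (g (Sup k) - g (Inf k))) \<le> L"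
  shows "\<exists>I. has_rs_integral f g I"
proof -
  have L: "L \<ge> 0"
    using bv[of "{{0..1}}"] order_trans[OF abs_ge_zero] division_of_self[of 0 "1::real"] by fastforce
  have "\<exists>P. eventually P mesh_filter \<and> (\<forall>p q. P p \<and> P q \<longrightarrow> dist (rs_sum f g p) (rs_sum f g q) < e)"
    if "e > 0" for e
  proof -
    \<comment> \<open>The 1 covers \<open>L = 0\<close> and makes \<open>e' * L < e\<close>
      strict.\<close>
    define e' where "e' = e / (L + 1)"
    have e': "e' > 0" "e' * L < e"
      using that L by (auto simp: e'_def field_simps)
    have "uniformly_continuous_on {0..1} f"
      using f by (intro compact_uniformly_continuous) auto
    then obtain \<delta> where \<delta>: "\<delta> > 0"
      "\<And>s t. s \<in> {0..1} \<Longrightarrow> t \<in> {0..1} \<Longrightarrow> dist s t < \<delta> \<Longrightarrow> dist (f s) (f t) < e'"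
      using e'(1) unfolding uniformly_continuous_on_def by metis
    \<comment> \<open>Radius \<open>\<delta>/2\<close>: two overlapping cells share a point, so
      their tags are less than \<open>\<delta>\<close> apart. Disjoint cells give no control of the
      tags, but their increment is 0.\<close>
    have "dist (rs_sum f g p) (rs_sum f g q) < e"
      if p: "p tagged_division_of {0..1}" "(\<lambda>t. ball t (\<delta>/2)) fine p"
        and q: "q tagged_division_of {0..1}" "(\<lambda>t. ball t (\<delta>/2)) fine q" for p q
    proof -
      have refine: "rs_sum f g p = (\<Sum>(t,k)\<in>p. \<Sum>(s,l)\<in>q. f t * increment g (k \<inter> l))"
        if p: "p tagged_division_of {0..1}" and q: "q tagged_division_of {0..1}" for p q
        unfolding rs_sum_def
      proof (intro sum.cong refl, clarify)
        fix t k assume tk: "(t, k) \<in> p"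
        obtain a b where k: "k = {a..b}" "a \<le> t" "t \<le> b" "0 \<le> a" "b \<le> 1"
          using tagged_division_01_cases[OF p tk] by blast
        have "f t * (g (Sup k) - g (Inf k)) = f t * increment g k"
          using k by (simp add: increment_def)
        also have "increment g k = (\<Sum>(s,l)\<in>q. increment g (k \<inter> l))"
          using k by (intro sum_increment_restrict[OF q, symmetric]) auto
        finally show "f t * (g (Sup k) - g (Inf k)) = (\<Sum>(s,l)\<in>q. f t * increment g (k \<inter> l))"
          by (simp add: sum_distrib_left split_def)
      qed
      have rq: "rs_sum f g q = (\<Sum>(t,k)\<in>p. \<Sum>(s,l)\<in>q. f s * increment g (k \<inter> l))"
        unfolding refine[OF q(1) p(1)] split_def by (subst sum.swap) (simp add: Int_commute)
      have "dist (rs_sum f g p) (rs_sum f g q) =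
          norm (\<Sum>(t,k)\<in>p. \<Sum>(s,l)\<in>q. (f t - f s) * increment g (k \<inter> l))"
        unfolding refine[OF p(1) q(1)] rq dist_norm
        by (simp add: split_def sum_subtractf left_diff_distrib)
      also have "\<dots> \<le> (\<Sum>(t,k)\<in>p. \<Sum>(s,l)\<in>q. e' * norm (increment g (k \<inter> l)))"
        unfolding split_def
      proof (intro sum_norm_le)
        fix x y assume xy: "x \<in> p" "y \<in> q"
        obtain t k s l where tk: "x = (t, k)" "y = (s, l)"
          by (cases x, cases y)
        show "norm ((f (fst x) - f (fst y)) * increment g (snd x \<inter> snd y))
            \<le> e' * norm (increment g (snd x \<inter> snd y))"
        proof (cases "k \<inter> l = {}")
          case False
          then obtain u where "u \<in> k" "u \<in> l" by blast
          moreover have "k \<subseteq> ball t (\<delta>/2)" "l \<subseteq> ball s (\<delta>/2)"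
            using p(2) q(2) xy tk by (auto simp: fine_def)
          ultimately have "dist t s < \<delta>"
            by (metis dist_triangle_half_l mem_ball subsetD)
          moreover have "t \<in> {0..1}" "s \<in> {0..1}"
            using tagged_division_ofD(2,3) p(1) q(1) xy tk by blast+
          ultimately have "norm (f t - f s) \<le> e'"
            using \<delta>(2) by (fastforce simp: dist_norm)
          then show ?thesis
            by (simp add: tk abs_mult mult_right_mono)
        qed (simp add: tk increment_def)
      qed
      also have "\<dots> = e' * (\<Sum>(t,k)\<in>p. \<Sum>(s,l)\<in>q. norm (increment g (k \<inter> l)))"
        by (simp add: sum_distrib_left split_def)
      also have "\<dots> \<le> e' * L"
        using e'(1) sum_norm_common_refinement_le[OF bv p(1) q(1)] by (intro mult_left_mono) auto
      finally show ?thesis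
        using e'(2) by simp
    qed
    then show ?thesis
      using \<delta>(1) unfolding eventually_mesh_filter
      by (intro exI[of _ "\<lambda>p. p tagged_division_of {0..1} \<and> (\<lambda>t. ball t (\<delta>/2)) fine p"])
        (auto intro!: exI[of _ "\<delta>/2"])
  qed
  then have "cauchy_filter (filtermap (rs_sum f g) mesh_filter)"
    by (simp add: cauchy_filter_metric_filtermap)
  moreover have "complete (UNIV :: real set)"
    by (rule complete_UNIV)
  ultimately obtain I where "(rs_sum f g \<longlongrightarrow> I) mesh_filter"
    using mesh_filter_neq_bot cauchy_filter_complete_converges
    by (force simp: filterlim_def filtermap_bot_iff)
  then show ?thesis
    by (auto simp: has_rs_integral_iff)
qed

section \<open>Line and curve integrals along rectifiable paths\<close>

lemma rectifiable_pathE: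
  assumes "rectifiable_path \<gamma>"
  obtains L where "\<And>d. d division_of {0..1} \<Longrightarrow> (\<Sum>k\<in>d. norm (\<gamma> (Sup k) - \<gamma> (Inf k))) \<le> L"
  using assms unfolding rectifiable_path_def by blast

text \<open>Both coordinates inherit the variation bound of the curve, so both integrals exist and
  can be merged into one limit of sums.\<close>

lemma line_integral_limit:
  assumes \<gamma>: "rectifiable_path \<gamma>"
    and P: "continuous_on (path_image \<gamma>) P" and R: "continuous_on (path_image \<gamma>) R"
  shows "((\<lambda>p. \<Sum>(t,k)\<in>p. P (\<gamma> t) * Re (\<gamma> (Sup k) - \<gamma> (Inf k)) + R (\<gamma> t) * Im (\<gamma> (Sup k) - \<gamma> (Inf k)))
    \<longlongrightarrow> line_integral \<gamma> P R) mesh_filter"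
proof -
  obtain L where L: "\<And>d. d division_of {0..1} \<Longrightarrow> (\<Sum>k\<in>d. norm (\<gamma> (Sup k) - \<gamma> (Inf k))) \<le> L"
    using rectifiable_pathE[OF \<gamma>] by metis
  have "continuous_on {0..1} \<gamma>"
    using \<gamma> by (simp add: rectifiable_path_def path_def)
  then have c: "continuous_on {0..1} (\<lambda>t. P (\<gamma> t))" "continuous_on {0..1} (\<lambda>t. R (\<gamma> t))"
    using continuous_on_compose2[OF P] continuous_on_compose2[OF R] by (auto simp: path_image_def)
  have "(\<Sum>k\<in>d. norm (Re (\<gamma> (Sup k)) - Re (\<gamma> (Inf k)))) \<le> L"
    "(\<Sum>k\<in>d. norm (Im (\<gamma> (Sup k)) - Im (\<gamma> (Inf k)))) \<le> L" if "d division_of {0..1}" for d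
    using abs_Re_le_cmod[of "\<gamma> (Sup k) - \<gamma> (Inf k)" for k]
      abs_Im_le_cmod[of "\<gamma> (Sup k) - \<gamma> (Inf k)" for k]
    by (auto intro!: order_trans[OF sum_mono L[OF that]])
  then obtain I J where "has_rs_integral (\<lambda>t. P (\<gamma> t)) (\<lambda>t. Re (\<gamma> t)) I"
    "has_rs_integral (\<lambda>t. R (\<gamma> t)) (\<lambda>t. Im (\<gamma> t)) J"
    using has_rs_integral_exists[OF c(1), of "\<lambda>t. Re (\<gamma> t)"]
      has_rs_integral_exists[OF c(2), of "\<lambda>t. Im (\<gamma> t)"] by metis
  then have "((\<lambda>p. rs_sum (\<lambda>t. P (\<gamma> t)) (\<lambda>t. Re (\<gamma> t)) p + rs_sum (\<lambda>t. R (\<gamma> t)) (\<lambda>t. Im (\<gamma> t)) p)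
    \<longlongrightarrow> line_integral \<gamma> P R) mesh_filter"
    unfolding line_integral_def by (intro tendsto_add) (simp_all add: rs_integral_eq has_rs_integral_iff)
  then show ?thesis
    by (simp add: rs_sum_def split_def sum.distrib)
qed

text \<open>Both parts must be shown to converge, even where only one of them is exact: otherwise the
  definite description in the curve integral would be a junk value.\<close>

lemma curve_integral_eq:
  assumes \<gamma>: "rectifiable_path \<gamma>" and f: "continuous_on (path_image \<gamma>) f"
  shows "curve_integral \<gamma> f =
    Complex (line_integral \<gamma> (\<lambda>z. Re (f z)) (\<lambda>z. - Im (f z))) (line_integral \<gamma> (\<lambda>z. Im (f z)) (\<lambda>z. Re (f z)))"
    (is "_ = Complex ?I ?J")
proof -
  have "((\<lambda>p. Complex (Re (rs_sum (\<lambda>t. f (\<gamma> t)) \<gamma> p)) (Im (rs_sum (\<lambda>t. f (\<gamma> t)) \<gamma> p)))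
      \<longlongrightarrow> Complex ?I ?J) mesh_filter"
  proof (rule tendsto_Complex)
    have "((\<lambda>p. \<Sum>(t,k)\<in>p. Re (f (\<gamma> t)) * Re (\<gamma> (Sup k) - \<gamma> (Inf k)) + - Im (f (\<gamma> t)) * Im (\<gamma> (Sup k) - \<gamma> (Inf k)))
      \<longlongrightarrow> ?I) mesh_filter"
      by (intro line_integral_limit \<gamma> continuous_intros f)
    then show "((\<lambda>p. Re (rs_sum (\<lambda>t. f (\<gamma> t)) \<gamma> p)) \<longlongrightarrow> ?I) mesh_filter"
      by (simp add: rs_sum_def split_def)
    have "((\<lambda>p. \<Sum>(t,k)\<in>p. Im (f (\<gamma> t)) * Re (\<gamma> (Sup k) - \<gamma> (Inf k)) + Re (f (\<gamma> t)) * Im (\<gamma> (Sup k) - \<gamma> (Inf k)))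
      \<longlongrightarrow> ?J) mesh_filter"
      by (intro line_integral_limit \<gamma> continuous_intros f)
    then show "((\<lambda>p. Im (rs_sum (\<lambda>t. f (\<gamma> t)) \<gamma> p)) \<longlongrightarrow> ?J) mesh_filter"
      by (simp add: rs_sum_def split_def add.commute)
  qed
  then show ?thesis
    by (simp add: curve_integral_def rs_integral_eq has_rs_integral_iff)
qed

text \<open>The increments of \<open>F\<close> along the curve telescope, and each is close to the
  linear term at its tag. The errors are proportional to the increments of the curve, so
  rectifiability bounds their total.\<close>

lemma line_integral_gradient:
  assumes \<gamma>: "rectifiable_path \<gamma>" "path_image \<gamma> \<subseteq> D" and D: "open D"
    and f: "continuous_on D f"
    and F: "\<And>z. z \<in> D \<Longrightarrow> (F has_derivative (\<lambda>h. Re (f z * h))) (at z)"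
  shows "line_integral \<gamma> (\<lambda>z. Re (f z)) (\<lambda>z. - Im (f z)) = F (pathfinish \<gamma>) - F (pathstart \<gamma>)"
    (is "?I = ?J")
proof -
  let ?d = "\<lambda>k. \<gamma> (Sup k) - \<gamma> (Inf k)"
  obtain L where L: "\<And>d. d division_of {0..1} \<Longrightarrow> (\<Sum>k\<in>d. norm (?d k)) \<le> L"
    using rectifiable_pathE[OF \<gamma>(1)] by metis
  have cont: "continuous_on {0..1} \<gamma>"
    using \<gamma> by (simp add: rectifiable_path_def path_def)
  have "((\<lambda>p. \<Sum>(t,k)\<in>p. Re (f (\<gamma> t)) * Re (?d k) + - Im (f (\<gamma> t)) * Im (?d k)) \<longlongrightarrow> ?I) mesh_filter"
    using f \<gamma>(2) by (intro line_integral_limit \<gamma> continuous_intros) (auto intro: continuous_on_subset)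
  then have lim: "((\<lambda>p. \<Sum>(t,k)\<in>p. Re (f (\<gamma> t) * ?d k)) \<longlongrightarrow> ?I) mesh_filter"
    by (simp add: split_def)
  \<comment> \<open>One \<open>e\<close> is the distance of the sum from its limit;
    \<open>e * L\<close> is the total linearization error.\<close>
  have near: "\<bar>?I - ?J\<bar> \<le> e + e * L" if "e > 0" for e
  proof -
    have "\<exists>\<eta>>0. \<forall>u\<in>{0..1}. \<forall>v\<in>{0..1}. u \<in> ball t \<eta> \<longrightarrow> v \<in> ball t \<eta> \<longrightarrow>
        \<bar>F (\<gamma> v) - F (\<gamma> u) - Re (f (\<gamma> t) * (\<gamma> v - \<gamma> u))\<bar> \<le> norm (\<gamma> v - \<gamma> u) * e" if t: "t \<in> {0..1}" for t
    proof -
      have \<gamma>t: "\<gamma> t \<in> D"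
        using t \<gamma>(2) by (auto simp: path_image_def)
      then obtain r1 where r1: "r1 > 0" "ball (\<gamma> t) r1 \<subseteq> D"
        using D open_contains_ball by blast
      have "isCont f (\<gamma> t)"
        using f D \<gamma>t by (simp add: continuous_on_eq_continuous_at)
      then obtain r2 where r2: "r2 > 0" "\<And>w. dist w (\<gamma> t) < r2 \<Longrightarrow> dist (f w) (f (\<gamma> t)) < e"
        using \<open>e > 0\<close> unfolding continuous_at_eps_delta by blast
      \<comment> \<open>On this ball \<open>F\<close> is differentiable and \<open>f\<close> varies
        by less than \<open>e\<close>; convexity keeps the segment from \<open>\<gamma> u\<close> to
        \<open>\<gamma> v\<close> inside, as the mean value inequality requires.\<close>
      define B where "B = ball (\<gamma> t) (min r1 r2)"
      have B: "\<gamma> t \<in> B" "convex B" "B \<subseteq> D" "\<And>w. w \<in> B \<Longrightarrow> dist (f w) (f (\<gamma> t)) < e"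
        using r1 r2 by (auto simp: B_def dist_commute)
      obtain \<eta> where \<eta>: "\<eta> > 0" "\<And>u. u \<in> {0..1} \<Longrightarrow> dist u t < \<eta> \<Longrightarrow> dist (\<gamma> u) (\<gamma> t) < min r1 r2"
        using cont t r1(1) r2(1) unfolding continuous_on_iff by (metis min_less_iff_conj)
      show ?thesis
      proof (intro exI[of _ \<eta>] conjI ballI impI \<eta>(1))
        fix u v assume uv: "u \<in> {0..1}" "v \<in> {0..1}" "u \<in> ball t \<eta>" "v \<in> ball t \<eta>"
        then have mem: "\<gamma> u \<in> B" "\<gamma> v \<in> B"
          using \<eta>(2)[of u] \<eta>(2)[of v] by (simp_all add: B_def dist_commute)
        have "norm (F (\<gamma> v) - F (\<gamma> u) - Re (f (\<gamma> t) * (\<gamma> v - \<gamma> u))) \<le> norm (\<gamma> v - \<gamma> u) * e"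
        proof (rule differentiable_bound_linearization[where S = B and f' = "\<lambda>x h. Re (f x * h)" and ?x0.0 = "\<gamma> t"])
          show "\<gamma> u + s *\<^sub>R (\<gamma> v - \<gamma> u) \<in> B" if "s \<in> {0..1}" for s
            using convexD_alt[OF B(2) mem, of s] that by (simp add: algebra_simps)
          show "(F has_derivative (\<lambda>h. Re (f x * h))) (at x within B)" if "x \<in> B" for x
            using F that B(3) by (blast intro: has_derivative_at_withinI)
          show "onorm ((\<lambda>h. Re (f x * h)) - (\<lambda>h. Re (f (\<gamma> t) * h))) \<le> e" if "x \<in> B" for x
          proof (rule onorm_le)
            fix h
            have "norm (((\<lambda>h. Re (f x * h)) - (\<lambda>h. Re (f (\<gamma> t) * h))) h) = \<bar>Re ((f x - f (\<gamma> t)) * h)\<bar>"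
              by (simp add: algebra_simps)
            also have "\<dots> \<le> norm (f x - f (\<gamma> t)) * norm h"
              by (metis abs_Re_le_cmod norm_mult)
            also have "\<dots> \<le> e * norm h"
              using B(4)[OF that] by (intro mult_right_mono) (auto simp: dist_norm)
            finally show "norm (((\<lambda>h. Re (f x * h)) - (\<lambda>h. Re (f (\<gamma> t) * h))) h) \<le> e * norm h" .
          qed
        qed (rule B(1))
        then show "\<bar>F (\<gamma> v) - F (\<gamma> u) - Re (f (\<gamma> t) * (\<gamma> v - \<gamma> u))\<bar> \<le> norm (\<gamma> v - \<gamma> u) * e"
          by simp
      qed
    qed
    then obtain \<eta> where \<eta>: "\<And>t. t \<in> {0..1} \<Longrightarrow> \<eta> t > 0"
      "\<And>t u v. t \<in> {0..1} \<Longrightarrow> u \<in> {0..1} \<Longrightarrow> v \<in> {0..1} \<Longrightarrow> u \<in> ball t (\<eta> t) \<Longrightarrow> v \<in> ball t (\<eta> t) \<Longrightarrow>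
        \<bar>F (\<gamma> v) - F (\<gamma> u) - Re (f (\<gamma> t) * (\<gamma> v - \<gamma> u))\<bar> \<le> norm (\<gamma> v - \<gamma> u) * e"
      by metis
    \<comment> \<open>The radius depends on the tag. The limit is already known to exist, so a
      single division that is fine for this gauge and has its sum near the limit is enough.\<close>
    have "gauge (\<lambda>t. ball t (if t \<in> {0..1} then \<eta> t else 1))"
      using \<eta>(1) by (auto simp: gauge_def)
    then have "\<exists>\<^sub>F p in mesh_filter. p tagged_division_of {0..1} \<and>
        (\<lambda>t. ball t (if t \<in> {0..1} then \<eta> t else 1)) fine p"
      by (rule frequently_mesh_filter_fine)
    moreover have "\<forall>\<^sub>F p in mesh_filter. dist (\<Sum>(t,k)\<in>p. Re (f (\<gamma> t) * ?d k)) ?I < e"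
      using lim \<open>e > 0\<close> by (rule tendstoD)
    ultimately obtain p where p: "p tagged_division_of {0..1}"
      "(\<lambda>t. ball t (if t \<in> {0..1} then \<eta> t else 1)) fine p"
      "dist (\<Sum>(t,k)\<in>p. Re (f (\<gamma> t) * ?d k)) ?I < e"
      using frequently_eventually_frequently frequently_ex by (smt (verit))
    have "?J = (\<Sum>(t,k)\<in>p. F (\<gamma> (Sup k)) - F (\<gamma> (Inf k)))"
      using additive_tagged_division_1[OF _ p(1), of "F \<circ> \<gamma>"]
      by (simp add: pathfinish_def pathstart_def)
    then have "\<bar>?J - (\<Sum>(t,k)\<in>p. Re (f (\<gamma> t) * ?d k))\<bar> =
        norm (\<Sum>(t,k)\<in>p. F (\<gamma> (Sup k)) - F (\<gamma> (Inf k)) - Re (f (\<gamma> t) * ?d k))"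
      by (simp only: split_def sum_subtractf real_norm_def)
    also have "\<dots> \<le> (\<Sum>(t,k)\<in>p. norm (?d k) * e)"
    proof (intro sum_norm_le, clarify)
      fix t k assume tk: "(t, k) \<in> p"
      obtain a b where k: "k = {a..b}" "a \<le> t" "t \<le> b" "0 \<le> a" "b \<le> 1"
        using tagged_division_01_cases[OF p(1) tk] by blast
      have "k \<subseteq> ball t (\<eta> t)"
        using fineD[OF p(2) tk] k by simp
      moreover have "a \<in> k" "b \<in> k"
        using k by auto
      ultimately have "a \<in> ball t (\<eta> t)" "b \<in> ball t (\<eta> t)"
        by blast+
      then show "norm (F (\<gamma> (Sup k)) - F (\<gamma> (Inf k)) - Re (f (\<gamma> t) * ?d k)) \<le> norm (?d k) * e"
        using \<eta>(2)[of t a b] k by auto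
    qed
    also have "\<dots> = e * (\<Sum>(t,k)\<in>p. norm (?d k))"
      by (simp add: split_def sum_distrib_left mult.commute)
    also have "\<dots> \<le> e * L"
      using \<open>e > 0\<close> sum_norm_tagged_le[OF L p(1)] by (intro mult_left_mono) auto
    finally show ?thesis
      using p(3) by (simp add: dist_real_def)
  qed
  have "((\<lambda>e. e + e * L) \<longlongrightarrow> 0 + 0 * L) (at_right 0)"
    by (intro tendsto_intros)
  then have "\<bar>?I - ?J\<bar> \<le> 0 + 0 * L"
    using near by (intro tendsto_lowerbound[of _ _ "at_right 0"])
      (auto simp: eventually_at_right_less intro: eventually_at_rightI[of 0 1])
  then show ?thesis
    by simp
qed

section \<open>Existence of joining curves and independence of \<open>A_op\<close> from the
  curve\<close>

lemma rectifiable_polynomial_function: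
  fixes \<gamma> :: "real \<Rightarrow> complex"
  assumes "polynomial_function \<gamma>"
  shows "rectifiable_path \<gamma>"
proof -
  obtain g where g: "polynomial_function g" "\<And>x. (\<gamma> has_vector_derivative g x) (at x)"
    using has_vector_derivative_polynomial_function[OF assms] by blast
  have "compact (g ` {0..1})"
    using g(1) by (intro compact_continuous_image continuous_on_polymonial_function) auto
  then obtain B where B: "\<And>x. x \<in> {0..1} \<Longrightarrow> norm (g x) \<le> B"
    using compact_imp_bounded bounded_iff by (metis imageI)
  \<comment> \<open>A bound on the derivative makes the path Lipschitz, and the lengths of the cells
    add up to 1.\<close>
  have lip: "norm (\<gamma> v - \<gamma> u) \<le> B * (v - u)" if "0 \<le> u" "u \<le> v" "v \<le> 1" for u v
  proof -
    have "norm (\<gamma> v - \<gamma> u) \<le> B * norm (v - u)"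
    proof (rule differentiable_bound[where S = "{0..1}" and f' = "\<lambda>x h. h *\<^sub>R g x"])
      show "(\<gamma> has_derivative (\<lambda>h. h *\<^sub>R g x)) (at x within {0..1})" for x
        using g(2) by (simp add: has_vector_derivative_def has_derivative_at_withinI)
      show "onorm (\<lambda>h. h *\<^sub>R g x) \<le> B" if "x \<in> {0..1}" for x
        using B[OF that] by (intro onorm_le) (simp add: mult.commute[of B] mult_left_mono)
    qed (use that in auto)
    then show ?thesis
      using that by simp
  qed
  have "(\<Sum>k\<in>d. norm (\<gamma> (Sup k) - \<gamma> (Inf k))) \<le> B" if d: "d division_of {0..1}" for d
  proof -
    have "(\<Sum>k\<in>d. norm (\<gamma> (Sup k) - \<gamma> (Inf k))) \<le> (\<Sum>k\<in>d. B * measure lborel k)"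
    proof (intro sum_mono)
      fix k assume k: "k \<in> d"
      obtain a b where ab: "k = {a..b}" using division_ofD(4)[OF d k] by auto
      moreover have "k \<noteq> {}" "k \<subseteq> {0..1}" using division_ofD(2,3)[OF d k] by auto
      ultimately show "norm (\<gamma> (Sup k) - \<gamma> (Inf k)) \<le> B * measure lborel k"
        using lip[of a b] by auto
    qed
    also have "\<dots> = B"
      using additive_content_division[of d 0 1] d by (simp flip: sum_distrib_left)
    finally show ?thesis .
  qed
  then show ?thesis
    unfolding rectifiable_path_def path_def
    using assms by (auto intro: continuous_on_polymonial_function)
qed

lemma joining_curve_exists:
  assumes "open D" "connected D" "z0 \<in> D" "z \<in> D"
  shows "\<exists>\<gamma>. joining_curve D z0 z \<gamma>"
  using connected_open_polynomial_connected[OF assms]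
  by (auto simp: joining_curve_def intro: rectifiable_polynomial_function)

text \<open>Whichever curve \<open>SOME\<close> selects, the gradient formula gives the same value;
  the existence of a joining curve ensures that the selection is a genuine one.\<close>

lemma A_op_eq:
  assumes "open D" "connected D" "z0 \<in> D" "z \<in> D" "continuous_on D f"
    and "\<And>z. z \<in> D \<Longrightarrow> (F has_derivative (\<lambda>h. Re (f z * h))) (at z)"
  shows "A_op D z0 c f z = 2 * (F z - F z0) + c"
proof -
  define \<gamma> where "\<gamma> = (SOME \<gamma>. joining_curve D z0 z \<gamma>)"
  have "joining_curve D z0 z \<gamma>"
    unfolding \<gamma>_def using joining_curve_exists[OF assms(1-4)] by (rule someI_ex)
  then have "line_integral \<gamma> (\<lambda>z. Re (f z)) (\<lambda>z. - Im (f z)) = F z - F z0"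
    using line_integral_gradient[of \<gamma> D f F] assms by (auto simp: joining_curve_def)
  then show ?thesis
    by (simp add: A_op_def flip: \<gamma>_def)
qed

section \<open>The Poincare lemma\<close>

text \<open>\<open>p\<close> and \<open>q\<close> are the partial derivatives of \<open>f\<close>; the last condition says that
  \<open>\<partial>\<^bsub>zbar\<^esub> f\<close> is real, i.e. that the real form \<open>Re (f dz)\<close> is closed.\<close>

definition closed_form :: "complex set \<Rightarrow> (complex \<Rightarrow> complex) \<Rightarrow> (complex \<Rightarrow> complex) \<Rightarrow> (complex \<Rightarrow> complex) \<Rightarrow> bool" where
  "closed_form D f p q \<longleftrightarrow> continuous_on D p \<and> continuous_on D q \<and>
    (\<forall>z\<in>D. (f has_derivative (\<lambda>h. of_real (Re h) * p z + of_real (Im h) * q z)) (at z) \<and>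
      Im (p z + \<i> * q z) = 0)"

lemma closed_form_continuous: "closed_form D f p q \<Longrightarrow> continuous_on D f"
  unfolding closed_form_def
  by (meson continuous_at_imp_continuous_on has_derivative_continuous)

text \<open>Integrate the form along the ray from 0 and differentiate under the integral sign.
  Closedness turns the resulting integrand into a \<open>t\<close>-derivative.\<close>

lemma Poincare_lemma_convex:
  assumes D: "open D" "convex D" "0 \<in> D" and f: "closed_form D f p q"
  shows "\<exists>F. \<forall>z\<in>D. (F has_derivative (\<lambda>h. Re (f z * h))) (at z)"
proof -
  define F where "F z = integral (cbox 0 1) (\<lambda>t::real. Re (f (t *\<^sub>R z) * z))" for z
  \<comment> \<open>The derivative in \<open>z\<close> of the integrand, written as a bounded linear
    map so that differentiation under the integral applies; \<open>Re\<close> and \<open>Im\<close>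
    span the real functionals.\<close>
  define f' where "f' z t = Re (of_real t * p (t *\<^sub>R z) * z + f (t *\<^sub>R z)) *\<^sub>R Blinfun Re +
    Re (of_real t * q (t *\<^sub>R z) * z + f (t *\<^sub>R z) * \<i>) *\<^sub>R Blinfun Im" for z and t :: real
  have f'_apply: "blinfun_apply (f' z t) h =
      Re (of_real t * (of_real (Re h) * p (t *\<^sub>R z) + of_real (Im h) * q (t *\<^sub>R z)) * z + f (t *\<^sub>R z) * h)" for z t h
    by (simp add: f'_def blinfun.add_left blinfun.scaleR_left bounded_linear_Blinfun_apply
        bounded_linear_Re bounded_linear_Im) (simp add: algebra_simps)
  have df: "(f has_derivative (\<lambda>h. of_real (Re h) * p z + of_real (Im h) * q z)) (at z)"
    and closed: "Im (p z) = - Re (q z)" if "z \<in> D" for z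
    using f that by (auto simp: closed_form_def)
  have cont [continuous_intros]: "continuous_on S (\<lambda>x. p (k x))" "continuous_on S (\<lambda>x. q (k x))" "continuous_on S (\<lambda>x. f (k x))"
    if "continuous_on S k" "\<And>x. x \<in> S \<Longrightarrow> k x \<in> D" for k and S :: "'x::topological_space set"
    using that f closed_form_continuous[OF f] unfolding closed_form_def
    by (auto intro: continuous_on_compose2)
  have ray: "t *\<^sub>R z \<in> D" if "z \<in> D" "t \<in> {0..1}" for t z
    using convexD_alt[OF D(2,3) that(1), of t] that(2) by simp
  have "(F has_derivative (\<lambda>h. Re (f z * h))) (at z)" if z: "z \<in> D" for z
  proof -
    have "(F has_derivative integral (cbox 0 1) (f' z)) (at z within D)"
      unfolding F_def
    proof (rule leibniz_rule[OF _ _ _ z D(2)])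
      fix x t assume x: "x \<in> D" and t: "t \<in> cbox 0 (1::real)"
      have "((\<lambda>x. f (t *\<^sub>R x)) has_derivative
          (\<lambda>h. of_real (Re (t *\<^sub>R h)) * p (t *\<^sub>R x) + of_real (Im (t *\<^sub>R h)) * q (t *\<^sub>R x))) (at x within D)"
        using ray[OF x] t by (intro has_derivative_compose[of _ "\<lambda>h. t *\<^sub>R h", OF _ df])
          (auto intro!: derivative_eq_intros)
      from has_derivative_mult[OF this has_derivative_ident]
      show "((\<lambda>x. Re (f (t *\<^sub>R x) * x)) has_derivative blinfun_apply (f' x t)) (at x within D)"
        by (rule has_derivative_eq_rhs[OF has_derivative_Re]) (auto simp: f'_apply fun_eq_iff algebra_simps)
    next
      show "(\<lambda>t. Re (f (t *\<^sub>R x) * x)) integrable_on cbox 0 1" if "x \<in> D" for x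
        using ray[OF that] by (intro integrable_continuous continuous_intros) auto
      show "continuous_on (D \<times> cbox 0 1) (\<lambda>(x, t). f' x t)"
        unfolding f'_def split_beta using ray by (intro continuous_intros) auto
    qed
    moreover have "blinfun_apply (integral (cbox 0 1) (f' z)) = (\<lambda>h. Re (f z * h))"
    proof
      fix h
      have "f' z integrable_on cbox 0 1"
        unfolding f'_def using ray[OF z] by (intro integrable_continuous continuous_intros) auto
      then have "blinfun_apply (integral (cbox 0 1) (f' z)) h = integral {0..1} (\<lambda>t. blinfun_apply (f' z t) h)"
        by (simp add: blinfun_apply_integral)
      \<comment> \<open>The antiderivative is \<open>t * Re (f (t *\<^sub>R z) * h)\<close>; its
        factor \<open>t\<close> removes the contribution of the lower end.\<close>
      also have "((\<lambda>t. blinfun_apply (f' z t) h) has_integral 1 * Re (f (1 *\<^sub>R z) * h) - 0 * Re (f (0 *\<^sub>R z) * h)) {0..1}"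
      proof (rule fundamental_theorem_of_calculus)
        fix t :: real assume t: "t \<in> {0..1}"
        have 1: "((\<lambda>t. f (t *\<^sub>R z)) has_derivative
            (\<lambda>s. of_real (Re (s *\<^sub>R z)) * p (t *\<^sub>R z) + of_real (Im (s *\<^sub>R z)) * q (t *\<^sub>R z))) (at t within {0..1})"
          using ray[OF z t] by (intro has_derivative_compose[of _ "\<lambda>s. s *\<^sub>R z", OF _ df])
            (auto intro!: derivative_eq_intros)
        have 2: "((\<lambda>t. t * Re (f (t *\<^sub>R z) * h)) has_derivative
            (\<lambda>s. t * Re ((of_real (Re (s *\<^sub>R z)) * p (t *\<^sub>R z) + of_real (Im (s *\<^sub>R z)) * q (t *\<^sub>R z)) * h)
              + s * Re (f (t *\<^sub>R z) * h))) (at t within {0..1})"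
          by (intro has_derivative_mult has_derivative_ident has_derivative_Re has_derivative_mult_left 1)
        show "((\<lambda>t. t * Re (f (t *\<^sub>R z) * h)) has_vector_derivative blinfun_apply (f' z t) h) (at t within {0..1})"
          unfolding has_vector_derivative_def
          \<comment> \<open>With \<open>Df\<close> the derivative of \<open>f\<close> at
            \<open>t *\<^sub>R z\<close>, this needs \<open>Re (Df h * z) = Re (Df z * h)\<close>, a
            symmetry that is equivalent to \<open>Im p = - Re q\<close>.\<close>
          by (rule has_derivative_eq_rhs[OF 2])
            (simp add: fun_eq_iff f'_apply closed[OF ray[OF z t]] algebra_simps)
      qed simp
      then have "integral {0..1} (\<lambda>t. blinfun_apply (f' z t) h) = Re (f z * h)"
        by (simp add: integral_unique)
      finally show "blinfun_apply (integral (cbox 0 1) (f' z)) h = Re (f z * h)" .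
    qed
    ultimately show ?thesis
      by (simp only: at_within_open[OF z D(1)])
  qed
  then show ?thesis by blast
qed

text \<open>The form \<open>Re (f dz)\<close> pulls back along a holomorphic \<open>g\<close> to \<open>Re ((f \<circ> g) g' dw)\<close>, and
  \<open>\<partial>\<^bsub>zbar\<^esub>\<close> of the new coefficient is that of \<open>f\<close> times \<open>\<bar>g'\<bar>\<^sup>2\<close>, so it stays real.\<close>

lemma closed_form_pullback:
  assumes f: "closed_form D f p q" and g: "g holomorphic_on U" "open U" "g ` U \<subseteq> D"
  shows "\<exists>p' q'. closed_form U (\<lambda>w. f (g w) * deriv g w) p' q'"
proof -
  \<comment> \<open>Chain and product rule in the directions 1 and \<open>\<i>\<close>, which
    \<open>g\<close> maps to \<open>g'\<close> and \<open>\<i> * g'\<close>. In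
    \<open>?p + \<i> * ?q\<close> the terms with the second derivative of \<open>g\<close>
    cancel.\<close>
  let ?p = "\<lambda>w. (of_real (Re (deriv g w)) * p (g w) + of_real (Im (deriv g w)) * q (g w)) * deriv g w + f (g w) * deriv (deriv g) w"
  let ?q = "\<lambda>w. (of_real (Re (deriv g w)) * q (g w) - of_real (Im (deriv g w)) * p (g w)) * deriv g w + \<i> * (f (g w) * deriv (deriv g) w)"
  have g': "deriv g holomorphic_on U" "deriv (deriv g) holomorphic_on U"
    using g by (simp_all add: holomorphic_deriv)
  note cont = holomorphic_on_imp_continuous_on[OF g(1)] g'[THEN holomorphic_on_imp_continuous_on]
  have cg: "continuous_on U (\<lambda>w. k (g w))" if "continuous_on D k" for k :: "complex \<Rightarrow> complex"
    using continuous_on_compose2[OF that cont(1) g(3)] .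
  have pq: "continuous_on D p" "continuous_on D q" "continuous_on D f"
    using f closed_form_continuous[OF f] by (auto simp: closed_form_def)
  have "closed_form U (\<lambda>w. f (g w) * deriv g w) ?p ?q"
    unfolding closed_form_def
  proof (intro conjI ballI)
    show "continuous_on U ?p" "continuous_on U ?q"
      by (intro continuous_intros cont cg pq)+
    fix w assume w: "w \<in> U"
    then have gw: "g w \<in> D" using g(3) by blast
    have "((\<lambda>w. f (g w)) has_derivative
        (\<lambda>h. of_real (Re (deriv g w * h)) * p (g w) + of_real (Im (deriv g w * h)) * q (g w))) (at w)"
      using f gw holomorphic_derivI[OF g(1,2) w]
      by (intro has_derivative_compose[of g "\<lambda>h. deriv g w * h" w UNIV f])
        (auto simp: closed_form_def has_field_derivative_def)
    moreover have "(deriv g has_derivative (\<lambda>h. deriv (deriv g) w * h)) (at w)"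
      using holomorphic_derivI[OF g'(1) g(2) w] by (simp add: has_field_derivative_def)
    ultimately have "((\<lambda>w. f (g w) * deriv g w) has_derivative (\<lambda>h. f (g w) * (deriv (deriv g) w * h) +
      (of_real (Re (deriv g w * h)) * p (g w) + of_real (Im (deriv g w * h)) * q (g w)) * deriv g w)) (at w)"
      by (rule has_derivative_mult)
    then show "((\<lambda>w. f (g w) * deriv g w) has_derivative (\<lambda>h. of_real (Re h) * ?p w + of_real (Im h) * ?q w)) (at w)"
      by (rule has_derivative_eq_rhs) (auto simp: fun_eq_iff complex_eq_iff algebra_simps)
    have "Im (p (g w)) = - Re (q (g w))"
      using f gw by (simp add: closed_form_def eq_neg_iff_add_eq_0)
    then show "Im (?p w + \<i> * ?q w) = 0"
      by (simp add: algebra_simps)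
  qed
  then show ?thesis by blast
qed

text \<open>The Riemann map \<open>\<phi>\<close> carries the primitive found on the disc back to
  \<open>D\<close>. The whole plane has no such map, but it is convex.\<close>

lemma Poincare_lemma_simply_connected:
  assumes D: "open D" "connected D" "simply_connected D" and f: "closed_form D f p q"
  obtains F where "\<And>z. z \<in> D \<Longrightarrow> (F has_derivative (\<lambda>h. Re (f z * h))) (at z)"
proof -
  consider "D = {}" | "D = UNIV" | \<phi> g where "\<phi> holomorphic_on D" "g holomorphic_on ball 0 1"
      "\<And>z. z \<in> D \<Longrightarrow> \<phi> z \<in> ball 0 1 \<and> g (\<phi> z) = z" "\<And>z. z \<in> ball 0 1 \<Longrightarrow> g z \<in> D"
    using simply_connected_eq_biholomorphic_to_disc[of D] D by blast
  then show ?thesis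
  proof cases
    case 2
    then show ?thesis
      using Poincare_lemma_convex[OF D(1) _ _ f] that by auto
  next
    case 3
    obtain p' q' where "closed_form (ball 0 1) (\<lambda>w. f (g w) * deriv g w) p' q'"
      using closed_form_pullback[OF f 3(2)] 3(4) by blast
    then obtain F where F: "\<And>w. w \<in> ball 0 1 \<Longrightarrow> (F has_derivative (\<lambda>h. Re (f (g w) * deriv g w * h))) (at w)"
      using Poincare_lemma_convex[of "ball 0 1"] by fastforce
    show ?thesis
    proof (rule that)
      fix z assume z: "z \<in> D"
      have d\<phi>: "(\<phi> has_field_derivative deriv \<phi> z) (at z)"
        using holomorphic_derivI[OF 3(1) D(1) z] .
      have "(g has_field_derivative deriv g (\<phi> z)) (at (\<phi> z))"
        using holomorphic_derivI[OF 3(2)] 3(3)[OF z] by simp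
      then have "((\<lambda>z. g (\<phi> z)) has_field_derivative deriv g (\<phi> z) * deriv \<phi> z) (at z)"
        using d\<phi> by (rule DERIV_chain2)
      moreover have "((\<lambda>z. g (\<phi> z)) has_field_derivative 1) (at z)"
        by (rule has_field_derivative_transform_within_open[OF DERIV_ident D(1) z]) (simp add: 3(3))
      \<comment> \<open>Since \<open>g\<close> inverts \<open>\<phi>\<close>, this product cancels
        the factor \<open>deriv g\<close> introduced by the pullback.\<close>
      ultimately have one: "deriv g (\<phi> z) * deriv \<phi> z = 1"
        by (rule DERIV_unique)
      have "((\<lambda>z. F (\<phi> z)) has_derivative (\<lambda>h. Re (f (g (\<phi> z)) * deriv g (\<phi> z) * (deriv \<phi> z * h)))) (at z)"
        using d\<phi> 3(3)[OF z] by (intro has_derivative_compose[of \<phi> "\<lambda>h. deriv \<phi> z * h" z UNIV F] F)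
          (auto simp: has_field_derivative_def)
      moreover have "f (g (\<phi> z)) * deriv g (\<phi> z) * (deriv \<phi> z * h) = f z * h" for h
        using 3(3)[OF z] one by (metis mult.assoc mult.right_neutral)
      ultimately show "((\<lambda>z. F (\<phi> z)) has_derivative (\<lambda>h. Re (f z * h))) (at z)"
        by simp
    qed
  qed (use that in auto)
qed

section \<open>Solutions of the Riccati equation\<close>

text \<open>Both \<open>\<bar>Q\<bar>\<^sup>2\<close> and \<open>\<nu>\<close> are real, so the
  imaginary part of the equation is exactly the closedness of \<open>Re (Q dz)\<close>.\<close>

lemma riccati_closed_form:
  assumes "riccati_solution \<Omega> \<nu> Q" "D \<subseteq> \<Omega>"
  shows "closed_form D Q (partial_x Q) (partial_y Q)"
  unfolding closed_form_def
proof (intro conjI ballI)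
  have Q: "continuously_differentiable \<Omega> Q"
    using assms(1) by (simp add: riccati_solution_def)
  then show "continuous_on D (partial_x Q)" "continuous_on D (partial_y Q)"
    using assms(2) by (auto simp: continuously_differentiable_def intro: continuous_on_subset)
  fix z assume z: "z \<in> D"
  then have z': "z \<in> \<Omega>" using assms(2) by blast
  then have d: "(Q has_derivative frechet_derivative Q (at z)) (at z)"
    using Q by (simp add: continuously_differentiable_def frechet_derivative_works)
  interpret linear "frechet_derivative Q (at z)"
    using d by (rule has_derivative_linear)
  \<comment> \<open>A real-linear map on the plane is determined by its values at 1 and
    \<open>\<i>\<close>.\<close>
  have "frechet_derivative Q (at z) h = of_real (Re h) * partial_x Q z + of_real (Im h) * partial_y Q z" for h
  proof -
    have "h = Re h *\<^sub>R 1 + Im h *\<^sub>R \<i>"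
      by (simp add: complex_eq_iff)
    then have "frechet_derivative Q (at z) h = frechet_derivative Q (at z) (Re h *\<^sub>R 1 + Im h *\<^sub>R \<i>)"
      by simp
    also have "\<dots> = Re h *\<^sub>R partial_x Q z + Im h *\<^sub>R partial_y Q z"
      unfolding add scale partial_x_def partial_y_def ..
    finally show ?thesis
      by (simp add: scaleR_conv_of_real)
  qed
  then show "(Q has_derivative (\<lambda>h. of_real (Re h) * partial_x Q z + of_real (Im h) * partial_y Q z)) (at z)"
    using d by presburger
  have "Im (partial_zbar Q z + of_real ((cmod (Q z))\<^sup>2)) = 0"
    using assms(1) z' by (simp only: riccati_solution_def Im_complex_of_real)
  then show "Im (partial_x Q z + \<i> * partial_y Q z) = 0"
    by (simp add: partial_zbar_def)
qed

lemma closed_form_add: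
  assumes "closed_form D f p q" "closed_form D f' p' q'"
  shows "closed_form D (\<lambda>z. f z + f' z) (\<lambda>z. p z + p' z) (\<lambda>z. q z + q' z)"
  using assms unfolding closed_form_def
  by (auto intro!: derivative_eq_intros continuous_intros simp: algebra_simps) (smt (verit))

lemma closed_form_diff:
  assumes "closed_form D f p q" "closed_form D f' p' q'"
  shows "closed_form D (\<lambda>z. f z - f' z) (\<lambda>z. p z - p' z) (\<lambda>z. q z - q' z)"
  using assms unfolding closed_form_def
  by (auto intro!: derivative_eq_intros continuous_intros simp: algebra_simps)

text \<open>The real form of \<open>\<partial>_z A[\<Phi>] = \<Phi>\<close>: on \<open>D\<close>,
  \<open>A_op\<close> is twice a primitive up to a constant.\<close>

lemma A_op_has_derivative:
  assumes D: "open D" "connected D" "simply_connected D" "z0 \<in> D" and f: "closed_form D f p q"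
    and z: "z \<in> D"
  shows "(A_op D z0 c f has_derivative (\<lambda>h. 2 * Re (f z * h))) (at z)"
proof -
  obtain F where F: "\<And>z. z \<in> D \<Longrightarrow> (F has_derivative (\<lambda>h. Re (f z * h))) (at z)"
    using Poincare_lemma_simply_connected[OF D(1-3) f] by blast
  have "((\<lambda>z. 2 * (F z - F z0) + c) has_derivative (\<lambda>h. 2 * Re (f z * h))) (at z)"
    using F[OF z] by (auto intro!: derivative_eq_intros)
  then show ?thesis
    by (rule has_derivative_transform_within_open[OF _ D(1) z])
      (simp add: A_op_eq[OF D(1,2,4) _ closed_form_continuous[OF f] F])
qed

lemma curve_integral_exact:
  assumes "rectifiable_path \<gamma>" "path_image \<gamma> \<subseteq> D" "pathfinish \<gamma> = pathstart \<gamma>" "open D"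
    and "continuous_on D f"
    and F: "\<And>z. z \<in> D \<Longrightarrow> (F has_derivative (\<lambda>h. Re (f z * h))) (at z)"
  shows "Re (curve_integral \<gamma> f) = 0"
  using line_integral_gradient[of \<gamma> D f F] curve_integral_eq[of \<gamma> f] continuous_on_subset assms
  by fastforce

theorem theorem12:
  fixes \<Omega> D :: "complex set"
    and \<nu> :: "complex \<Rightarrow> real"
    and Q0 Q1 :: "complex \<Rightarrow> complex"
    and \<Gamma> :: "real \<Rightarrow> complex"
    and z1 z2 :: complex
    and c1 c2 :: real
  assumes "open \<Omega>" and "connected \<Omega>"
    and "riccati_solution \<Omega> \<nu> Q0" and "bounded (Q0 ` \<Omega>)"
    and "riccati_solution \<Omega> \<nu> Q1" and "bounded (Q1 ` \<Omega>)"
    and "open D" and "connected D" and "simply_connected D" and "D \<subseteq> \<Omega>"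
    and "z1 \<in> D" and "z2 \<in> D"
    and "rectifiable_path \<Gamma>" and "pathfinish \<Gamma> = pathstart \<Gamma>" and "path_image \<Gamma> \<subseteq> D"
  shows "complex_of_real (Re (curve_integral \<Gamma>
             (\<lambda>z. (Q1 z - Q0 z) * exp (complex_of_real (A_op D z1 c1 (\<lambda>w. Q1 w - Q0 w) z)))))
       + \<i> * complex_of_real (Im (curve_integral \<Gamma>
             (\<lambda>z. (Q1 z - Q0 z) * exp (complex_of_real (A_op D z2 c2 (\<lambda>w. Q1 w + Q0 w) z))))) = 0"
proof -
  define W where "W z = Q1 z - Q0 z" for z
  define S where "S z = Q1 z + Q0 z" for z
  define A where "A = A_op D z1 c1 W"
  define B where "B = A_op D z2 c2 S"
  define f where "f z = W z * exp (complex_of_real (A z))" for z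
  define g where "g z = W z * exp (complex_of_real (B z))" for z
  define pW where "pW z = partial_x Q1 z - partial_x Q0 z" for z
  define qW where "qW z = partial_y Q1 z - partial_y Q0 z" for z
  note Q0 = riccati_closed_form[OF assms(3) \<open>D \<subseteq> \<Omega>\<close>] and Q1 = riccati_closed_form[OF assms(5) \<open>D \<subseteq> \<Omega>\<close>]
  note D = \<open>open D\<close> \<open>connected D\<close> \<open>simply_connected D\<close>
  have W: "closed_form D W pW qW"
    unfolding W_def pW_def qW_def by (rule closed_form_diff[OF Q1 Q0])
  have S: "closed_form D S (\<lambda>z. partial_x Q1 z + partial_x Q0 z) (\<lambda>z. partial_y Q1 z + partial_y Q0 z)"
    unfolding S_def by (rule closed_form_add[OF Q1 Q0])
  have dA: "(A has_derivative (\<lambda>h. 2 * Re (W z * h))) (at z)"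
    and dB: "(B has_derivative (\<lambda>h. 2 * Re (S z * h))) (at z)" if "z \<in> D" for z
    unfolding A_def B_def using that W S D \<open>z1 \<in> D\<close> \<open>z2 \<in> D\<close> by (blast intro: A_op_has_derivative)+
  have contA: "continuous_on D A" and contB: "continuous_on D B"
    using dA dB by (meson continuous_at_imp_continuous_on has_derivative_continuous)+
  note cont = contA contB closed_form_continuous[OF W] closed_form_continuous[OF S]
  have "Re (curve_integral \<Gamma> f) = 0"
  \<comment> \<open>The half offsets the factor 2 in the derivative of \<open>A\<close>.\<close>
  proof (rule curve_integral_exact[where D = D and F = "\<lambda>z. exp (A z) / 2"])
    show "continuous_on D f"
      unfolding f_def by (intro continuous_intros cont)
    show "((\<lambda>z. exp (A z) / 2) has_derivative (\<lambda>h. Re (f z * h))) (at z)" if "z \<in> D" for z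
      using dA[OF that] by (auto intro!: derivative_eq_intros simp: f_def exp_of_real field_simps)
  qed (use assms in auto)
  moreover have "Im (curve_integral \<Gamma> g) = 0"
  proof -
    \<comment> \<open>The factor \<open>- \<i>\<close> converts the imaginary part of the form into
      a real part.\<close>
    let ?e = "\<lambda>z. - \<i> * complex_of_real (exp (B z))"
    \<comment> \<open>Product rule: the partial derivatives of \<open>B\<close> are
      \<open>2 * Re (S z)\<close> and \<open>- 2 * Im (S z)\<close>, so their combination
      \<open>B_x + \<i> * B_y\<close> is \<open>2 * cnj (S z)\<close>.\<close>
    let ?p = "\<lambda>z. ?e z * (2 * of_real (Re (S z)) * W z + pW z)"
    let ?q = "\<lambda>z. ?e z * (- 2 * of_real (Im (S z)) * W z + qW z)"
    have "closed_form D (\<lambda>z. ?e z * W z) ?p ?q"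
      unfolding closed_form_def
    proof (intro conjI ballI)
      show "continuous_on D ?p" "continuous_on D ?q"
        using W by (auto intro!: continuous_intros cont simp: closed_form_def)
      fix z assume z: "z \<in> D"
      have "(W has_derivative (\<lambda>h. of_real (Re h) * pW z + of_real (Im h) * qW z)) (at z)"
        using W z by (simp add: closed_form_def)
      then show "((\<lambda>z. ?e z * W z) has_derivative (\<lambda>h. of_real (Re h) * ?p z + of_real (Im h) * ?q z)) (at z)"
        using dB[OF z] by (auto intro!: derivative_eq_intros simp: fun_eq_iff complex_eq_iff algebra_simps)
      have "Re (partial_zbar Q z) + (cmod (Q z))\<^sup>2 = \<nu> z / 4" if "riccati_solution \<Omega> \<nu> Q" for Q
      proof -
        have "partial_zbar Q z + of_real ((cmod (Q z))\<^sup>2) = of_real (\<nu> z / 4)"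
          using that z \<open>D \<subseteq> \<Omega>\<close> by (auto simp: riccati_solution_def)
        from arg_cong[OF this, of Re] show ?thesis
          by simp
      qed
      from this[OF assms(3)] this[OF assms(5)]
      \<comment> \<open>Subtraction eliminates \<open>\<nu>\<close>. The 2 clears the half in
        \<open>partial_zbar\<close>.\<close>
      have "Re (pW z + \<i> * qW z) + 2 * ((cmod (Q1 z))\<^sup>2 - (cmod (Q0 z))\<^sup>2) = 0"
        by (simp add: partial_zbar_def pW_def qW_def field_simps)
      moreover have "Re (W z * cnj (S z)) = (cmod (Q1 z))\<^sup>2 - (cmod (Q0 z))\<^sup>2"
        unfolding W_def S_def cmod_power2 by (simp add: algebra_simps power2_eq_square)
      ultimately have "Re (pW z + \<i> * qW z) + 2 * Re (W z * cnj (S z)) = 0"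
        by simp
      moreover have "Im (?p z + \<i> * ?q z) = - exp (B z) * (Re (pW z + \<i> * qW z) + 2 * Re (W z * cnj (S z)))"
        by (simp add: algebra_simps)
      ultimately show "Im (?p z + \<i> * ?q z) = 0"
        by simp
    qed
    then obtain F where F: "\<And>z. z \<in> D \<Longrightarrow> (F has_derivative (\<lambda>h. Re (?e z * W z * h))) (at z)"
      using Poincare_lemma_simply_connected[OF D] by blast
    have cg: "continuous_on D g"
      unfolding g_def by (intro continuous_intros cont)
    \<comment> \<open>Its coefficients are \<open>Im g\<close> and \<open>Re g\<close>, those of the
      imaginary part of the curve integral; on a closed curve the end values of \<open>F\<close>
      cancel.\<close>
    have "line_integral \<Gamma> (\<lambda>z. Re (- \<i> * g z)) (\<lambda>z. - Im (- \<i> * g z)) = F (pathfinish \<Gamma>) - F (pathstart \<Gamma>)"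
    proof (rule line_integral_gradient[where D = D])
      show "(F has_derivative (\<lambda>h. Re (- \<i> * g z * h))) (at z)" if "z \<in> D" for z
        using F[OF that] by (simp add: g_def exp_of_real algebra_simps)
    qed (use assms in \<open>auto intro!: continuous_intros cg\<close>)
    then show ?thesis
      using curve_integral_eq[of \<Gamma> g] continuous_on_subset[OF cg] assms by simp
  qed
  ultimately show ?thesis
    unfolding f_def g_def A_def B_def W_def S_def by (simp add: complex_eq_iff)
qed

end
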